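(* Let $a$ be a complex number. The elliptic curve $$E:\ y^2-axy-y=x^3-x$$ defines (by the construction $E\mapsto g$ given in the context) a pseudo-involution $(g(x),xg(x))$ in the Riordan group whose $B$-sequence has generating function $$B(x)=\frac{2-a+(1-3a+a^2)x}{1+(1-a)x}.$$
   Context: All power series are formal, with complex coefficients. Riordan arrays: for $g(x)=1+g_1x+\cdots$ and $f(x)=f_1x+f_2x^2+\cdots$ with $f_1\neq 0$, the Riordan array $(g(x),f(x))$ is the infinite lower triangular matrix with entries $t_{n,k}=[x^n]\,g(x)f(x)^k$, $n,k\ge 0$. It acts on power series by $(g(x),f(x))\cdot h(x)=g(x)h(f(x))$. The product of Riordan arrays is $(g,f)\cdot(u,v)=(g(x)u(f(x)),v(f(x)))$, and the identity is $(1,x)$; with this product Riordan arrays form the Riordan group. A Bell array is a Riordan array of the form $(g(x),xg(x))$ with $g(0)=1$. It is a (Bell) pseudo-involution if $(g(x),-xg(x))^2=(1,x)$. $B$-sequence: the $B$-sequence of a Bell pseudo-involution $(g(x),xg(x))$ with entries $t_{n,k}$ is the sequence $b_0,b_1,b_2,\ldots$ such that, for all $n,k\ge 0$, $$t_{n+1,k}=t_{n,k-1}+\sum_{j\ge 0} b_j\, t_{n-j,k+j},$$ where $t_{n,-1}=0$ and $t_{m,l}=0$ whenever $m<0$ or $l>m$. Its generating function is $B(x)=\sum_{j\ge0} b_jx^j$. Construction of $g$ from $E$: (1) Let $y(x)=\frac{1+ax-\sqrt{1+2(a-2)x+a^2x^2+4x^3}}{2}=x+(1-a)x^2+\cdots$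 be the power series solution of $y^2-axy-y=x^3-x$ with $y(0)=0$. (2) Let $s(x)=\frac{y(x)-x}{x^2}$. (3) Let $h(x)=\frac{1}{1-x-x^2s(x)}$. (4) Let $r(x)$ be the compositional inverse of the power series $xh(x)$, and let $v(x)=r(x)/x$. (5) Let $f(x)=\frac{1}{1-x^2v(x)}$. (6) Let $$g(x)=\left(\frac{1}{1+(a-1)x},\ \frac{-x}{1+(a-1)x}\right)\cdot\frac{f(x)(1+(a-1)x)-1}{x f(x)(ax+a-1)},$$ where the dot denotes the action of a Riordan array on a power series. *)

theory Defs
  imports Complex_Main "HOL-Computational_Algebra.Formal_Power_Series"
begin

unbundle fps_syntax

section \<open>Riordan arrays\<close>

text \<open>
  A Riordan array is given by the pair of power series \<open>(g, f)\<close>; its matrix is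
  \<open>riordan_entry (g, f)\<close>.
\<close>

type_synonym riordan = "complex fps \<times> complex fps"

definition riordan_arrays :: "riordan set" where
  "riordan_arrays = {(g, f). g $ 0 = 1 \<and> f $ 0 = 0 \<and> f $ 1 \<noteq> 0}"

definition riordan_entry :: "riordan \<Rightarrow> nat \<Rightarrow> nat \<Rightarrow> complex" where
  "riordan_entry = (\<lambda>(g, f) n k. (g * f ^ k) $ n)"

definition riordan_act :: "riordan \<Rightarrow> complex fps \<Rightarrow> complex fps" where
  "riordan_act = (\<lambda>(g, f) h. g * (h oo f))"

definition riordan_mult :: "riordan \<Rightarrow> riordan \<Rightarrow> riordan" where
  "riordan_mult = (\<lambda>(g, f) (u, v). (g * (u oo f), v oo f))"

definition riordan_one :: riordan where
  "riordan_one = (1, fps_X)"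

definition is_bell_array :: "riordan \<Rightarrow> bool" where
  "is_bell_array R \<longleftrightarrow> R \<in> riordan_arrays \<and> (\<exists>g. g $ 0 = 1 \<and> R = (g, fps_X * g))"

definition is_bell_pseudo_involution :: "riordan \<Rightarrow> bool" where
  "is_bell_pseudo_involution R \<longleftrightarrow> is_bell_array R \<and>
     (case R of (g, f) \<Rightarrow> riordan_mult (g, - f) (g, - f) = riordan_one)"

text \<open>
  The terms with \<open>j > n\<close> of the defining sum vanish because the row index \<open>n - j\<close> is negative;
  they are left out because subtraction on \<open>nat\<close> truncates. The terms with \<open>k + j > n - j\<close> vanish
  because the matrix is lower triangular (\<open>riordan_entry_eq_0\<close>).
\<close>

definition is_B_sequence :: "riordan \<Rightarrow> (nat \<Rightarrow> complex) \<Rightarrow> bool" where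
  "is_B_sequence R b \<longleftrightarrow> (\<forall>n k. riordan_entry R (n + 1) k =
     (if k = 0 then 0 else riordan_entry R n (k - 1)) +
     (\<Sum>j\<le>n. b j * riordan_entry R (n - j) (k + j)))"

lemma riordan_entry_eq_0:
  assumes "R \<in> riordan_arrays" "n < k"
  shows "riordan_entry R n k = 0"
proof -
  obtain g f where R: "R = (g, f)" by (cases R)
  with assms(1) have "f $ 0 = 0" by (simp add: riordan_arrays_def)
  then have "(f ^ k) $ i = 0" if "i \<le> n" for i
    using that assms(2) startsby_zero_power_prefix[of f k] by auto
  then show ?thesis
    by (auto simp: R riordan_entry_def fps_mult_nth intro!: sum.neutral)
qed

lemma bell_entry_diag:
  assumes "is_bell_array R"
  shows "riordan_entry R n n = 1"
proof -
  obtain g where g: "g $ 0 = 1" "R = (g, fps_X * g)"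
    using assms by (auto simp: is_bell_array_def)
  have "g * (fps_X * g) ^ n = fps_X ^ n * g ^ Suc n"
    by (simp add: power_mult_distrib algebra_simps)
  then show ?thesis
    using g by (simp add: riordan_entry_def fps_X_power_mult_nth fps_power_zeroth del: power_Suc)
qed

text \<open>A Bell array has at most one \<open>B\<close>-sequence, so one may speak of \<^emph>\<open>the\<close> \<open>B\<close>-sequence.\<close>

lemma is_B_sequence_unique:
  assumes R: "is_bell_array R" and b: "is_B_sequence R b" and c: "is_B_sequence R c"
  shows "b = c"
proof
  fix m
  show "b m = c m"
  proof (induction m rule: less_induct)
    case (less m)
    have R': "R \<in> riordan_arrays" using R by (simp add: is_bell_array_def)
    have split: "(\<Sum>j\<le>2*m. d j * riordan_entry R (2*m - j) j) =
        (\<Sum>j<m. d j * riordan_entry R (2*m - j) j) + d m" for d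
    proof -
      have "(\<Sum>j\<le>2*m. d j * riordan_entry R (2*m - j) j) =
          (\<Sum>j\<le>m. d j * riordan_entry R (2*m - j) j)"
        by (rule sum.mono_neutral_right) (auto intro!: riordan_entry_eq_0 R')
      also have "\<dots> = (\<Sum>j<m. d j * riordan_entry R (2*m - j) j) + d m"
        using bell_entry_diag[OF R, of m]
        by (simp add: lessThan_Suc_atMost[symmetric] mult_2)
      finally show ?thesis .
    qed
    have "(\<Sum>j\<le>2*m. b j * riordan_entry R (2*m - j) j) =
        (\<Sum>j\<le>2*m. c j * riordan_entry R (2*m - j) j)"
      using b[unfolded is_B_sequence_def, rule_format, of "2*m" 0]
        c[unfolded is_B_sequence_def, rule_format, of "2*m" 0] by simp
    moreover have "(\<Sum>j<m. b j * riordan_entry R (2*m - j) j) =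
        (\<Sum>j<m. c j * riordan_entry R (2*m - j) j)"
      using less by simp
    ultimately show ?case by (simp add: split)
  qed
qed


section \<open>From the elliptic curve to the Bell array\<close>

text \<open>\<open>csqrt\<close> enters only through \<open>csqrt 1 = 1\<close>: it selects the square root with constant term 1.\<close>

definition y_series :: "complex \<Rightarrow> complex fps" where
  "y_series a = (1 + fps_const a * fps_X -
     fps_radical (\<lambda>_. csqrt) 2
       (1 + fps_const (2 * (a - 2)) * fps_X + fps_const (a^2) * fps_X ^ 2 + 4 * fps_X ^ 3)) / 2"

definition s_series :: "complex \<Rightarrow> complex fps" where
  "s_series a = (y_series a - fps_X) / fps_X ^ 2"

definition h_series :: "complex \<Rightarrow> complex fps" where
  "h_series a = 1 / (1 - fps_X - fps_X ^ 2 * s_series a)"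

definition v_series :: "complex \<Rightarrow> complex fps" where
  "v_series a = fps_inv (fps_X * h_series a) / fps_X"

definition f_series :: "complex \<Rightarrow> complex fps" where
  "f_series a = 1 / (1 - fps_X ^ 2 * v_series a)"

text \<open>
  The denominator of the second quotient has subdegree 1 if \<open>a \<noteq> 1\<close> and 2 if \<open>a = 1\<close>. The numerator
  has at least that subdegree, so the quotient is exact.
\<close>

definition g_series :: "complex \<Rightarrow> complex fps" where
  "g_series a = (let d = 1 + fps_const (a - 1) * fps_X; f = f_series a in
     riordan_act (1 / d, - fps_X / d)
       ((f * d - 1) / (fps_X * f * (fps_const a * fps_X + fps_const (a - 1)))))"

lemma y_series_0: "y_series a $ 0 = 0"
  by (simp add: y_series_def fps_divide_unit)

lemma y_series_on_curve:
  "(y_series a) ^ 2 - fps_const a * fps_X * y_series a - y_series a = fps_X ^ 3 - fps_X"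
proof -
  let ?D = "1 + fps_const (2 * (a - 2)) * fps_X + fps_const (a^2) * fps_X ^ 2 + 4 * fps_X ^ 3"
  define R where "R = fps_radical (\<lambda>_. csqrt) 2 ?D"
  define A where "A = fps_const a"
  define y where "y = y_series a"
  have "?D = 1 + 2 * (A - 2) * fps_X + A^2 * fps_X ^ 2 + 4 * fps_X ^ 3"
    by (simp add: A_def numeral_fps_const fps_const_power)
  moreover have "R ^ 2 = ?D"
    using power_radical[of ?D "\<lambda>_. csqrt" 1] by (simp add: R_def numeral_2_eq_2)
  ultimately have R2: "R ^ 2 = 1 + 2 * (A - 2) * fps_X + A^2 * fps_X ^ 2 + 4 * fps_X ^ 3"
    by simp
  have "2 * y = 2 * ((1 + A * fps_X - R) / 2)"
    by (simp add: y_def y_series_def R_def A_def)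
  also have "\<dots> = 1 + A * fps_X - R"
    by (simp add: fps_divide_unit numeral_fps_const fps_const_inverse
        mult.left_commute[of _ _ "fps_const (inverse 2)"] mult.assoc[symmetric])
  finally have "R = 1 + A * fps_X - 2 * y" by (simp add: algebra_simps)
  with R2 have "(1 + A * fps_X - 2 * y) ^ 2
      = 1 + 2 * (A - 2) * fps_X + A^2 * fps_X ^ 2 + 4 * fps_X ^ 3" by simp
  then have "4 * (y ^ 2 - A * fps_X * y - y) = 4 * (fps_X ^ 3 - fps_X)"
    by (simp add: algebra_simps power2_eq_square)
  moreover have "(4 :: complex fps) \<noteq> 0" by simp
  ultimately have "y ^ 2 - A * fps_X * y - y = fps_X ^ 3 - fps_X"
    using mult_left_cancel by blast
  then show ?thesis by (simp only: A_def y_def)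
qed

text \<open>
  The explicit formula defining \<open>y_series\<close> is the power series solution with zero constant
  term of the equation of the curve.
\<close>

lemma y_series_iff:
  "y ^ 2 - fps_const a * fps_X * y - y = fps_X ^ 3 - fps_X \<and> y $ 0 = 0 \<longleftrightarrow> y = y_series a"
proof
  assume y: "y ^ 2 - fps_const a * fps_X * y - y = fps_X ^ 3 - fps_X \<and> y $ 0 = 0"
  let ?u = "y + y_series a - fps_const a * fps_X - 1"
  have "(y - y_series a) * ?u = (y ^ 2 - fps_const a * fps_X * y - y) -
      (y_series a ^ 2 - fps_const a * fps_X * y_series a - y_series a)"
    by (simp add: algebra_simps power2_eq_square)
  then have "(y - y_series a) * ?u = 0"
    using y y_series_on_curve[of a] by simp
  moreover have "?u $ 0 = -1" using y by (simp add: y_series_0)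
  then have "?u \<noteq> 0" by (metis fps_zero_nth zero_neq_neg_one)
  ultimately show "y = y_series a" by simp
qed (simp add: y_series_0 y_series_on_curve)

end

theory Submission
  imports Defs
begin

text \<open>
  Since \<open>h = 1 / (1 - y)\<close>, the inverse \<open>r = x v\<close> of \<open>x h\<close> satisfies \<open>y(r) = 1 - v\<close>, so the equation
  of the curve becomes quadratic in \<open>v\<close>. Carried through the remaining steps, it becomes the relation
  \<open>G - x = x G B(x G)\<close> for \<open>G = x g\<close>. On generating functions of columns this relation is the
  recurrence defining the \<open>B\<close>-sequence. It is also invariant under \<open>(x, G) \<mapsto> (-G, -x)\<close>, and it has
  only one power series solution, so \<open>G(-G) = -x\<close>.
\<close>

text \<open>Powers \<open>w ^ j\<close> have no coefficient below degree \<open>j\<close>, so the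
  inner sums can all be extended to the same range and swapped. The cut-off \<open>j \<le> n\<close>
  is the one in \<open>is_B_sequence\<close>.\<close>

lemma fps_mult_compose_nth:
  fixes u b w :: "'a :: comm_ring_1 fps"
  assumes "w $ 0 = 0"
  shows "(u * (b oo w)) $ n = (\<Sum>j\<le>n. b $ j * (u * w ^ j) $ n)"
proof -
  have "(u * (b oo w)) $ n = (\<Sum>i=0..n. u $ i * (\<Sum>j=0..n-i. b $ j * (w ^ j) $ (n - i)))"
    by (simp add: fps_mult_nth fps_compose_nth)
  also have "\<dots> = (\<Sum>i=0..n. u $ i * (\<Sum>j=0..n. b $ j * (w ^ j) $ (n - i)))"
    using startsby_zero_power_prefix[OF assms]
    by (intro sum.cong refl arg_cong2[where f = times] sum.mono_neutral_left) auto
  also have "\<dots> = (\<Sum>j=0..n. \<Sum>i=0..n. b $ j * (u $ i * (w ^ j) $ (n - i)))"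
    by (subst sum.swap) (simp add: sum_distrib_left algebra_simps)
  finally show ?thesis
    by (simp add: fps_mult_nth sum_distrib_left atLeast0AtMost)
qed

text \<open>Multiplying the hypothesis by \<open>G ^ k\<close> gives an equation for the generating
  function \<open>u\<close> of column \<open>k\<close>. Its term \<open>u * (fps_X * G) ^ j\<close>
  is column \<open>k + j\<close> moved down by \<open>j\<close> rows, which yields the entries
  \<open>(n - j, k + j)\<close> of the recurrence.\<close>

lemma is_B_sequence_bellI:
  fixes g b :: "complex fps"
  assumes g: "g = 1 + fps_X * g * (b oo (fps_X * (fps_X * g)))"
  shows "is_B_sequence (g, fps_X * g) (fps_nth b)"
  unfolding is_B_sequence_def
proof (intro allI)
  fix n k
  define G where "G = fps_X * g"
  define u where "u = g * G ^ k"
  have column: "u = G ^ k + fps_X * (u * (b oo (fps_X * G)))"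
    unfolding u_def G_def by (subst (1) g) (simp add: algebra_simps)
  have shift: "(u * (fps_X * G) ^ j) $ n = (g * G ^ (k + j)) $ (n - j)" if "j \<le> n" for j
  proof -
    have "u * (fps_X * G) ^ j = fps_X ^ j * (g * G ^ (k + j))"
      by (simp add: u_def power_mult_distrib power_add algebra_simps)
    then show ?thesis using that by (simp add: fps_X_power_mult_nth)
  qed
  \<comment> \<open>For \<open>k > 0\<close>, \<open>G ^ k\<close> is column \<open>k - 1\<close>
    shifted by one row; for \<open>k = 0\<close> it is 1, matching the convention for column
    -1.\<close>
  have "G ^ k $ (n + 1) = (if k = 0 then 0 else (g * G ^ (k - 1)) $ n)"
    by (cases k) (simp_all add: G_def mult.assoc)
  moreover have "(u * (b oo (fps_X * G))) $ n = (\<Sum>j\<le>n. b $ j * (g * G ^ (k + j)) $ (n - j))"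
    by (simp add: fps_mult_compose_nth shift)
  moreover have "u $ (n + 1) = G ^ k $ (n + 1) + (u * (b oo (fps_X * G))) $ n"
    by (subst column) simp
  ultimately show "riordan_entry (g, fps_X * g) (n + 1) k =
      (if k = 0 then 0 else riordan_entry (g, fps_X * g) n (k - 1)) +
      (\<Sum>j\<le>n. b $ j * riordan_entry (g, fps_X * g) (n - j) (k + j))"
    by (simp add: riordan_entry_def u_def G_def)
qed

text \<open>The condition on the second component suffices: expanded as a product and divided by
  \<open>fps_X\<close>, it becomes the condition \<open>g * (g oo ?F) = 1\<close> on the
  first.\<close>

lemma is_bell_pseudo_involutionI:
  assumes g0: "g $ 0 = 1"
    and inv: "(fps_X * g) oo (- (fps_X * g)) = - fps_X"
  shows "is_bell_pseudo_involution (g, fps_X * g)"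
proof -
  let ?F = "- (fps_X * g)"
  have F0: "?F $ 0 = 0" by simp
  have "?F * (g oo ?F) = - fps_X"
    using inv by (simp only: fps_compose_mult_distrib[OF F0] fps_X_fps_compose_startby0[OF F0])
  then have "fps_X * (g * (g oo ?F)) = fps_X * 1" by (simp add: mult.assoc)
  then have "g * (g oo ?F) = 1"
    using mult_left_cancel[OF fps_X_neq_zero] by blast
  moreover have "?F oo ?F = fps_X"
    using inv by (simp add: fps_compose_uminus)
  ultimately show ?thesis
    using g0 by (simp add: is_bell_pseudo_involution_def is_bell_array_def riordan_arrays_def
        riordan_mult_def riordan_one_def)
qed

lemma y_series_1: "y_series a $ 1 = 1"
proof -
  have "(y_series a ^ 2) $ 1 = 0"
    by (simp add: power2_eq_square fps_mult_nth y_series_0)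
  then show ?thesis
    using arg_cong[OF y_series_on_curve[of a], of "\<lambda>z. z $ 1"]
    by (simp add: mult.assoc y_series_0 fps_X_power_iff)
qed

text \<open>The quotient defining \<open>s_series\<close> is exact because \<open>y_series a\<close>
  begins with \<open>fps_X\<close>.\<close>

lemma fps_X_sq_mult_s_series: "fps_X ^ 2 * s_series a = y_series a - fps_X"
proof -
  have "fps_X ^ 2 dvd y_series a - fps_X"
  proof (cases "y_series a - fps_X = 0")
    case False
    then have "2 \<le> subdegree (y_series a - fps_X)"
      using y_series_0[of a] y_series_1[of a]
      by (intro subdegree_geI) (auto simp: less_2_cases_iff)
    with False show ?thesis by (simp add: fps_dvd_iff)
  qed simp
  then show ?thesis unfolding s_series_def by (rule dvd_mult_div_cancel)
qed

lemma h_series_mult: "h_series a * (1 - y_series a) = 1"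
proof -
  have "1 - fps_X - fps_X ^ 2 * s_series a = 1 - y_series a"
    unfolding fps_X_sq_mult_s_series by simp
  then have "h_series a = 1 / (1 - y_series a)"
    by (simp only: h_series_def)
  then show ?thesis by (simp add: fps_divide_unit inverse_mult_eq_1 y_series_0)
qed

lemma v_series_eq:
  "fps_X ^ 3 * v_series a ^ 2 - (1 + fps_const a * fps_X) * v_series a
    + 1 + fps_const (a - 1) * fps_X = 0"
proof -
  define y where "y = y_series a"
  define h where "h = h_series a"
  define r where "r = fps_inv (fps_X * h)"
  define v where "v = 1 - (y oo r)"
  have hy: "h * (1 - y) = 1" by (simp add: h_def y_def h_series_mult)
  have y0: "y $ 0 = 0" by (simp add: y_def y_series_0)
  have h0: "h $ 0 = 1"
    using arg_cong[OF hy, of "\<lambda>z. z $ 0"] y0 by simp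
  have r0: "r $ 0 = 0" by (simp add: r_def fps_inv_def)
  have "(fps_X * h) oo r = fps_X"
    unfolding r_def by (rule fps_inv_right) (simp_all add: h0)
  then have rh: "r * (h oo r) = fps_X"
    by (simp add: fps_compose_mult_distrib[OF r0] fps_X_fps_compose_startby0[OF r0])
  have "(h oo r) * v = 1"
    using arg_cong[OF hy, of "\<lambda>z. z oo r"]
    by (simp add: v_def fps_compose_mult_distrib[OF r0] fps_compose_sub_distrib)
  then have r: "r = fps_X * v"
    using rh by algebra
  then have v: "v_series a = v"
    unfolding v_series_def h_def[symmetric] r_def[symmetric]
    by (metis fps_X_neq_zero nonzero_mult_div_cancel_left)
  have v0: "v $ 0 = 1" by (simp add: v_def y0)
  have "(1 - v) ^ 2 - fps_const a * r * (1 - v) - (1 - v) = r ^ 3 - r"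
    using arg_cong[OF y_series_on_curve[of a], of "\<lambda>z. z oo r"]
    by (simp add: v_def y_def fps_compose_mult_distrib[OF r0] fps_compose_sub_distrib
        fps_compose_power[OF r0, symmetric] fps_X_fps_compose_startby0[OF r0])
  \<comment> \<open>With \<open>r = fps_X * v\<close> both sides are divisible by \<open>v\<close>,
    since \<open>(1 - v) ^ 2 - (1 - v) = - v * (1 - v)\<close>. Cancelling \<open>v\<close> lowers
    the cubic to a quadratic.\<close>
  then have "v * (fps_X ^ 3 * v ^ 2 - (1 + fps_const a * fps_X) * v
      + 1 + (fps_const a - 1) * fps_X) = 0"
    unfolding r by algebra
  moreover have "v \<noteq> 0" using v0 by force
  ultimately show "fps_X ^ 3 * v_series a ^ 2 - (1 + fps_const a * fps_X) * v_series a
      + 1 + fps_const (a - 1) * fps_X = 0"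
    by (simp add: v fps_const_sub[symmetric] del: fps_const_sub)
qed

lemma
  shows g_series_0: "g_series a $ 0 = 1"
    and g_series_eq: "(g_series a - 1) * (1 - fps_const (a - 1) * (fps_X * (fps_X * g_series a))) =
      fps_X * g_series a *
        (fps_const (2 - a) + fps_const (1 - 3 * a + a ^ 2) * (fps_X * (fps_X * g_series a)))"
proof -
  define A where "A = fps_const a"
  define d where "d = 1 + (A - 1) * fps_X"
  define L where "L = A * fps_X + (A - 1)"
  define v where "v = v_series a"
  define f where "f = f_series a"
  define D where "D = inverse d"
  define \<phi> where "\<phi> = - (fps_X * D)"
  define H where "H = (f * d - 1) / (fps_X * f * L)"
  define H' where "H' = H oo \<phi>"
  define g where "g = D * H'"
  have d0: "d $ 0 = 1" by (simp add: d_def A_def)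
  have Dd: "D * d = 1" by (simp add: D_def inverse_mult_eq_1 d0)
  have coeffs: "fps_const (a - 1) = A - 1" "fps_const (2 - a) = 2 - A"
    "fps_const (1 - 3 * a + a ^ 2) = 1 - 3 * A + A ^ 2"
    by (simp_all add: A_def numeral_fps_const fps_const_power flip: fps_const_1_eq_1)
  have "- fps_X / d = \<phi>" "1 / d = D"
    by (simp_all add: \<phi>_def D_def d0 fps_divide_unit)
  then have g: "g_series a = g"
    by (simp add: g_series_def Let_def coeffs riordan_act_def g_def H'_def H_def f_def d_def L_def
        flip: A_def)
  have \<phi>0: "\<phi> $ 0 = 0" by (simp add: \<phi>_def)
  have f: "f * (1 - fps_X ^ 2 * v) = 1"
    by (simp add: f_def f_series_def v_def fps_divide_unit inverse_mult_eq_1)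
  then have f_nz: "f \<noteq> 0" by auto
  have "L $ 0 = a - 1" "L $ 1 = a" by (simp_all add: L_def A_def)
  then have L_nz: "L \<noteq> 0" by auto
  have v_eq: "fps_X ^ 3 * v ^ 2 - (1 + A * fps_X) * v + 1 + (A - 1) * fps_X = 0"
    using v_series_eq[of a] by (simp only: coeffs v_def A_def)
  have num: "f * d - 1 = (fps_X * f) * (A - 1 + fps_X * v)"
    using f unfolding d_def by algebra
  \<comment> \<open>For \<open>a = 1\<close> the divisor \<open>L\<close> is \<open>fps_X\<close>,
    not a unit, but the right side is then \<open>fps_X * v\<close>; otherwise \<open>L\<close> is a
    unit.\<close>
  have HL: "H * L = A - 1 + fps_X * v"
  proof (cases "a = 1")
    case True
    then have [simp]: "A = 1" by (simp add: A_def)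
    have "H = (fps_X * f * fps_X * v) / (fps_X * f * fps_X)"
      unfolding H_def num by (simp add: L_def mult.assoc)
    then have "H = v" using f_nz by simp
    then show ?thesis by (simp add: L_def)
  next
    case False
    then have "L dvd 1" by (simp add: fps_is_unit_iff L_def A_def)
    then have "L dvd A - 1 + fps_X * v" using dvd_trans one_dvd by blast
    moreover have "H = (A - 1 + fps_X * v) div L"
      unfolding H_def num using f_nz by (simp add: mult.assoc)
    ultimately show ?thesis by simp
  qed
  \<comment> \<open>This is \<open>fps_X\<close> times the quadratic for \<open>v\<close>, with
    \<open>fps_X * v = H * L - (A - 1)\<close>. The terms free of \<open>H\<close> add up to
    \<open>L * d\<close>, so \<open>L\<close> factors out.\<close>
  have "L * (fps_X ^ 2 * L * H ^ 2 - 2 * (A - 1) * fps_X ^ 2 * H - (1 + A * fps_X) * H + d) = 0"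
    using HL v_eq unfolding L_def d_def by algebra
  then have "fps_X ^ 2 * L * H ^ 2 - 2 * (A - 1) * fps_X ^ 2 * H - (1 + A * fps_X) * H + d = 0"
    using L_nz by simp
  then have "(fps_X ^ 2 * L * H ^ 2 - 2 * (A - 1) * fps_X ^ 2 * H - (1 + A * fps_X) * H + d) oo \<phi> = 0"
    by simp
  then have "\<phi> ^ 2 * (A * \<phi> + (A - 1)) * H' ^ 2 - 2 * (A - 1) * \<phi> ^ 2 * H' - (1 + A * \<phi>) * H'
      + (1 + (A - 1) * \<phi>) = 0"
    by (simp add: L_def d_def H'_def A_def numeral_fps_const fps_compose_mult_distrib[OF \<phi>0]
        fps_compose_sub_distrib fps_compose_add_distrib fps_compose_power[OF \<phi>0, symmetric]
        fps_X_fps_compose_startby0[OF \<phi>0] flip: fps_const_1_eq_1)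
  moreover have H': "H' = d * g" "\<phi> * d = - fps_X"
    using Dd unfolding g_def \<phi>_def by algebra+
  moreover have "d * (1 + (A - 1) * \<phi>) = 1"
    using H'(2) unfolding d_def by algebra
  \<comment> \<open>Multiplying by \<open>d\<close> clears every denominator of
    \<open>\<phi>\<close>; the linear term simplifies by
    \<open>d - A * fps_X = 1 - fps_X\<close>.\<close>
  ultimately have g_eq: "((A - 1) * d - A * fps_X) * fps_X ^ 2 * g ^ 2 - 2 * (A - 1) * fps_X ^ 2 * g
      - (1 - fps_X) * d * g + 1 = 0"
    unfolding d_def by algebra
  show "g_series a $ 0 = 1"
    using arg_cong[OF g_eq, of "\<lambda>z. z $ 0"] d0
    by (simp add: g power2_eq_square[of fps_X] mult.assoc)
  \<comment> \<open>The coefficient \<open>1 - 3 * a + a ^ 2\<close> is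
    \<open>(a - 1) ^ 2 - a\<close>, the linear coefficient of
    \<open>(A - 1) * d - A * fps_X\<close>.\<close>
  show "(g_series a - 1) * (1 - fps_const (a - 1) * (fps_X * (fps_X * g_series a))) =
      fps_X * g_series a *
        (fps_const (2 - a) + fps_const (1 - 3 * a + a ^ 2) * (fps_X * (fps_X * g_series a)))"
    using g_eq unfolding coeffs g d_def by algebra
qed

theorem proposition19:
  fixes a :: complex
  shows "is_bell_pseudo_involution (g_series a, fps_X * g_series a) \<and>
    (\<exists>b. is_B_sequence (g_series a, fps_X * g_series a) b \<and>
         Abs_fps b = (fps_const (2 - a) + fps_const (1 - 3 * a + a ^ 2) * fps_X) /
                     (1 + fps_const (1 - a) * fps_X))"
proof
  define g where "g = g_series a"
  define G where "G = fps_X * g"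
  define p where "p = fps_const (a - 1)"
  define q where "q = fps_const (2 - a)"
  define s where "s = fps_const (1 - 3 * a + a ^ 2)"
  have g0: "g $ 0 = 1" by (simp add: g_def g_series_0)
  have g_eq: "(g - 1) * (1 - p * (fps_X * G)) = fps_X * g * (q + s * (fps_X * G))"
    using g_series_eq[of a] by (simp add: g_def G_def p_def q_def s_def)
  have G_eq: "(G - fps_X) * (1 - p * (fps_X * G)) = fps_X * G * (q + s * (fps_X * G))"
    using g_eq unfolding G_def by algebra
  have G0: "(- G) $ 0 = 0" by (simp add: G_def)
  define Q where "Q = G oo (- G)"
  \<comment> \<open>Read as a polynomial equation for \<open>Q\<close> with coefficients in
    \<open>G\<close>, this has \<open>- fps_X\<close> as another solution: that substitution gives
    back \<open>G_eq\<close>.\<close>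
  have "(Q + G) * (1 + p * (G * Q)) = - G * Q * (q - s * (G * Q))"
    using arg_cong[OF G_eq, of "\<lambda>z. z oo (- G)"]
    by (simp add: Q_def p_def q_def s_def fps_compose_mult_distrib[OF G0] fps_compose_sub_distrib
        fps_compose_add_distrib fps_X_fps_compose_startby0[OF G0])
  \<comment> \<open>The second factor is the difference quotient of the relation between \<open>Q\<close> and \<open>- fps_X\<close>.\<close>
  then have "(Q + fps_X) * (1 + G * (p * (Q - fps_X + G) + q - s * G * (Q - fps_X))) = 0"
    using G_eq by algebra
  moreover have "(1 + G * (p * (Q - fps_X + G) + q - s * G * (Q - fps_X))) $ 0 = 1"
    using G0 by simp
  then have "1 + G * (p * (Q - fps_X + G) + q - s * G * (Q - fps_X)) \<noteq> 0"
    by (metis fps_zero_nth zero_neq_one)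
  ultimately have "Q = - fps_X"
    using eq_neg_iff_add_eq_0 by auto
  then show "is_bell_pseudo_involution (g_series a, fps_X * g_series a)"
    using is_bell_pseudo_involutionI[OF g0] by (simp add: Q_def G_def g_def)

  let ?den = "1 + fps_const (1 - a) * fps_X"
  define B where "B = (q + s * fps_X) / ?den"
  have "B * ?den = q + s * fps_X"
    by (simp add: B_def fps_divide_unit inverse_mult_eq_1 mult.assoc)
  moreover have "?den = 1 - p * fps_X"
    by (simp add: p_def algebra_simps flip: fps_const_sub)
  ultimately have "(B * (1 - p * fps_X)) oo (fps_X * G) = (q + s * fps_X) oo (fps_X * G)"
    by simp
  moreover have XG0: "(fps_X * G) $ 0 = 0" by simp
  ultimately have "(B oo (fps_X * G)) * (1 - p * (fps_X * G)) = q + s * (fps_X * G)"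
    by (simp add: p_def q_def s_def fps_compose_mult_distrib[OF XG0] fps_compose_sub_distrib
        fps_compose_add_distrib fps_X_fps_compose_startby0[OF XG0])
  \<comment> \<open>Here \<open>g_eq\<close> and the equation for \<open>B oo (fps_X * G)\<close>
    share the factor \<open>1 - p * (fps_X * G)\<close>, which has constant term 1 and
    cancels.\<close>
  then have "(1 - p * (fps_X * G)) * (g - (1 + fps_X * g * (B oo (fps_X * G)))) = 0"
    using g_eq by algebra
  moreover have "(1 - p * (fps_X * G)) $ 0 = 1" by simp
  then have "1 - p * (fps_X * G) \<noteq> 0" by (metis fps_zero_nth zero_neq_one)
  ultimately have "g = 1 + fps_X * g * (B oo (fps_X * (fps_X * g)))"
    by (simp add: G_def)
  then have "is_B_sequence (g, fps_X * g) (fps_nth B)"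
    by (rule is_B_sequence_bellI)
  then show "\<exists>b. is_B_sequence (g_series a, fps_X * g_series a) b \<and>
      Abs_fps b = (fps_const (2 - a) + fps_const (1 - 3 * a + a ^ 2) * fps_X) /
                  (1 + fps_const (1 - a) * fps_X)"
    by (intro exI[of _ "fps_nth B"]) (simp add: g_def B_def q_def s_def fps_nth_inverse)
qed

end
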